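(* Let $G$ and $H$ be graphs, let $k\in\mathrm{Fall}(G[H])$, and let $f$ be a fall $k$-coloring of $G[H]$. Then for each $x\in V(G)$, writing $S_x:=f(V(H_x))$, the restriction of $f$ to $V(H_x)$ is a fall $|S_x|$-coloring of $H_x$ with color set $S_x$ (that is, it is a proper coloring of $H_x$ in which every vertex of $H_x$ sees all colors of $S_x$ on its closed neighborhood in $H_x$).
   Context: All graphs are finite, simple (undirected, no loops, no multiple edges), with nonempty vertex set. For $k\in\mathbb{N}=\{1,2,\dots\}$ let $[k]=\{1,\dots,k\}$. A (proper) $k$-coloring of a graph $G$ is a function $f:V(G)\to[k]$ such that each $f^{-1}(i)$ is an independent set. It is a fall $k$-coloring if $f(N[v])=[k]$ for every $v\in V(G)$, where $N[v]$ is the closed neighborhood of $v$; any set of $k$ colors may be used in place of $[k]$. $\mathrm{Fall}(G)$ is the set of all positive integers $k$ such that $G$ has a fall $k$-coloring. The lexicographic product $G[H]$ has vertex set $V(G)\times V(H)$, with $(x_1,y_1)$ adjacent to $(x_2,y_2)$ iff $\{x_1,x_2\}\in E(G)$, or $x_1=x_2$ and $\{y_1,y_2\}\in E(H)$. For $x\in V(G)$, $H_x$ is the subgraph of $G[H]$ induced on $\{x\}\times V(H)$. *)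

theory Defs
  imports "Graph_Theory.Graph_Theory" "HOL-Library.FuncSet"
begin

text \<open>
  Finite simple undirected graphs are represented by the locale \<open>pair_graph\<close>: finitely many
  vertices and a symmetric irreflexive arc relation, an undirected edge being a pair of opposite
  arcs. The colouring notions are defined for arbitrary \<open>pre_digraph\<close>s, so that they also apply
  to the library's induced subgraphs; \<open>with_proj\<close> is a coercion.
\<close>

definition independent_set :: "('a, 'b) pre_digraph \<Rightarrow> 'a set \<Rightarrow> bool" where
  "independent_set G I \<longleftrightarrow> I \<subseteq> verts G \<and> (\<forall>u\<in>I. \<forall>v\<in>I. \<not> u \<rightarrow>\<^bsub>G\<^esub> v)"

definition closed_neighborhood :: "('a, 'b) pre_digraph \<Rightarrow> 'a \<Rightarrow> 'a set" where
  "closed_neighborhood G v = insert v {u \<in> verts G. v \<rightarrow>\<^bsub>G\<^esub> u}"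

text \<open>
  In the next two definitions \<open>C\<close> is the set of \<open>k\<close> colours, so that an arbitrary colour set may
  replace \<open>{1..k}\<close>. Only the values of \<open>f\<close> on the vertices of \<open>G\<close> matter.
\<close>

definition proper_coloring ::
    "('a, 'b) pre_digraph \<Rightarrow> nat \<Rightarrow> 'c set \<Rightarrow> ('a \<Rightarrow> 'c) \<Rightarrow> bool" where
  "proper_coloring G k C f \<longleftrightarrow>
     finite C \<and> card C = k \<and> f \<in> verts G \<rightarrow> C \<and>
     (\<forall>i\<in>C. independent_set G {v \<in> verts G. f v = i})"

definition fall_coloring ::
    "('a, 'b) pre_digraph \<Rightarrow> nat \<Rightarrow> 'c set \<Rightarrow> ('a \<Rightarrow> 'c) \<Rightarrow> bool" where
  "fall_coloring G k C f \<longleftrightarrow>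
     proper_coloring G k C f \<and> (\<forall>v\<in>verts G. f ` closed_neighborhood G v = C)"

definition Fall :: "('a, 'b) pre_digraph \<Rightarrow> nat set" where
  "Fall G = {k. k \<ge> 1 \<and> (\<exists>f :: 'a \<Rightarrow> nat. fall_coloring G k {1..k} f)}"

definition lex_product ::
    "'a pair_pre_digraph \<Rightarrow> 'b pair_pre_digraph \<Rightarrow> ('a \<times> 'b) pair_pre_digraph" where
  "lex_product G H =
     \<lparr> pverts = pverts G \<times> pverts H,
       parcs = {((x1, y1), (x2, y2)) | x1 y1 x2 y2.
          x1 \<in> pverts G \<and> y1 \<in> pverts H \<and> x2 \<in> pverts G \<and> y2 \<in> pverts H \<and>
          ((x1, x2) \<in> parcs G \<or> (x1 = x2 \<and> (y1, y2) \<in> parcs H))} \<rparr>"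

text \<open>The copy of \<open>H\<close> in the lexicographic product that sits at the vertex \<open>x\<close> of \<open>G\<close>.\<close>

definition lex_layer ::
    "'a pair_pre_digraph \<Rightarrow> 'b pair_pre_digraph \<Rightarrow> 'a
      \<Rightarrow> ('a \<times> 'b, ('a \<times> 'b) \<times> ('a \<times> 'b)) pre_digraph" where
  "lex_layer G H x = with_proj (lex_product G H) \<restriction> ({x} \<times> pverts H)"

lemma pair_graph_lex_product:
  assumes "pair_graph G" "pair_graph H"
  shows "pair_graph (lex_product G H)"
proof -
  interpret G: pair_graph G by fact
  interpret H: pair_graph H by fact
  have sG: "sym (parcs G)" and sH: "sym (parcs H)"
    using G.pair_sym_arcs H.pair_sym_arcs by (simp_all add: symmetric_def)
  have sub: "parcs (lex_product G H) \<subseteq> (pverts G \<times> pverts H) \<times> (pverts G \<times> pverts H)"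
    by (auto simp: lex_product_def)
  have fin: "finite (parcs (lex_product G H))"
    by (rule finite_subset[OF sub]) (simp add: G.pair_finite_verts H.pair_finite_verts)
  have symP: "sym (parcs (lex_product G H))"
    using sG sH unfolding sym_def by (auto simp: lex_product_def)
  show ?thesis
  proof
    show "finite (parcs (lex_product G H))" by (rule fin)
    show "symmetric (with_proj (lex_product G H))" using symP by (simp add: symmetric_def)
  qed (use G.pair_no_loops H.pair_no_loops in
        \<open>force simp: lex_product_def G.pair_finite_verts H.pair_finite_verts\<close>)+
qed

end

theory Submission
  imports Defs
begin

text \<open>
  Two vertices of the layer over \<open>x\<close> have the same neighbours outside that layer. Hence if
  \<open>(x, y)\<close> saw a colour of the layer, say \<open>f (x, z)\<close>, at a vertex \<open>w\<close> outside the layer, then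
  \<open>w\<close> would also be adjacent to \<open>(x, z)\<close>, which has the same colour. So \<open>(x, y)\<close> must see every
  colour of the layer inside the layer.
\<close>

lemma parcs_lex_product:
  "((x1, y1), (x2, y2)) \<in> parcs (lex_product G H) \<longleftrightarrow>
     x1 \<in> pverts G \<and> y1 \<in> pverts H \<and> x2 \<in> pverts G \<and> y2 \<in> pverts H \<and>
     ((x1, x2) \<in> parcs G \<or> x1 = x2 \<and> (y1, y2) \<in> parcs H)"
  by (simp add: lex_product_def)

lemma verts_lex_layer [simp]: "verts (lex_layer G H x) = {x} \<times> pverts H"
  by (simp add: lex_layer_def)

text \<open>The layer is an induced subgraph, so its adjacencies can be traded for adjacencies of
  the product, where properness of \<open>f\<close> applies.\<close>

lemma dominates_lex_layer:
  "u \<rightarrow>\<^bsub>lex_layer G H x\<^esub> v \<longleftrightarrow>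
     u \<in> {x} \<times> pverts H \<and> v \<in> {x} \<times> pverts H \<and> u \<rightarrow>\<^bsub>with_proj (lex_product G H)\<^esub> v"
  by (auto simp: lex_layer_def arcs_ends_def arc_to_ends_def)

lemma proper_coloring_neq:
  assumes "proper_coloring D k C f" "u \<in> verts D" "v \<in> verts D" "u \<rightarrow>\<^bsub>D\<^esub> v"
  shows "f u \<noteq> f v"
  using assms unfolding proper_coloring_def independent_set_def by blast

theorem theorem1:
  fixes G :: "'a pair_pre_digraph" and H :: "'b pair_pre_digraph"
    and k :: nat and C :: "'c set" and f :: "'a \<times> 'b \<Rightarrow> 'c"
  assumes "pair_graph G" and "pverts G \<noteq> {}"
    and "pair_graph H" and "pverts H \<noteq> {}"
    and "k \<in> Fall (with_proj (lex_product G H))"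
    and "fall_coloring (with_proj (lex_product G H)) k C f"
  shows "\<forall>x\<in>pverts G.
    let V = verts (lex_layer G H x); S = f ` V
    in fall_coloring (lex_layer G H x) (card S) S (restrict f V)"
proof
  fix x assume x: "x \<in> pverts G"
  let ?P = "with_proj (lex_product G H)" and ?L = "lex_layer G H x"
  let ?V = "{x} \<times> pverts H"
  let ?g = "restrict f ?V"
  interpret H: pair_graph H by fact
  have vP: "pverts (lex_product G H) = pverts G \<times> pverts H"
    by (simp add: lex_product_def)
  have proper: "proper_coloring ?P k C f"
    using assms(6) by (simp add: fall_coloring_def)
  have neq: "f u \<noteq> f v" if "u \<in> verts ?P" "v \<in> verts ?P" "u \<rightarrow>\<^bsub>?P\<^esub> v" for u v
    using proper_coloring_neq[OF proper that] .
  \<comment> \<open>Properness passes to induced subgraphs; the colour set shrinks to the image of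
    the layer, finite because \<open>H\<close> is.\<close>
  have properL: "proper_coloring ?L (card (f ` ?V)) (f ` ?V) ?g"
    unfolding proper_coloring_def independent_set_def
    using x neq by (fastforce simp: H.pair_finite_verts dominates_lex_layer vP)
  have sees: "?g ` closed_neighborhood ?L v = f ` ?V" if v: "v \<in> ?V" for v
  proof
    show "?g ` closed_neighborhood ?L v \<subseteq> f ` ?V"
      using v by (auto simp: closed_neighborhood_def)
    show "f ` ?V \<subseteq> ?g ` closed_neighborhood ?L v"
    proof
      fix s assume "s \<in> f ` ?V"
      then obtain z where z: "z \<in> pverts H" "s = f (x, z)" by auto
      obtain y where y: "v = (x, y)" "y \<in> pverts H" using v by auto
      \<comment> \<open>As a colour of the product, \<open>s\<close> must be seen by
        \<open>v\<close> somewhere in the product; \<open>w\<close> is such a place.\<close>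
      have "f (x, z) \<in> C"
        using proper x z vP by (auto simp: proper_coloring_def)
      also have "C = f ` closed_neighborhood ?P v"
        using assms(6) x y vP by (simp add: fall_coloring_def)
      finally obtain w where w: "w \<in> closed_neighborhood ?P v" "f w = s"
        using z by auto
      obtain a b where ab: "w = (a, b)" by fastforce
      have "a \<in> pverts G" "b \<in> pverts H"
        using w(1) ab x y vP by (auto simp: closed_neighborhood_def)
      \<comment> \<open>Otherwise \<open>w\<close> would be adjacent to \<open>(x, z)\<close>,
        whatever \<open>b\<close> and \<open>z\<close> are, although both have colour
        \<open>s\<close>.\<close>
      then have "(x, a) \<notin> parcs G"
        using neq[of "(x, z)" w] w(2) z x by (auto simp: parcs_lex_product vP ab)
      \<comment> \<open>Either \<open>w = v\<close>, or the arc from \<open>v\<close> to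
        \<open>w\<close> comes from \<open>H\<close>, which forces \<open>a = x\<close>.\<close>
      then have "w \<in> closed_neighborhood ?L v \<and> w \<in> ?V"
        using w(1) y ab
        by (auto simp: closed_neighborhood_def dominates_lex_layer parcs_lex_product)
      \<comment> \<open>Since \<open>w\<close> lies in \<open>?V\<close>, \<open>?g\<close> agrees
        with \<open>f\<close> there.\<close>
      then show "s \<in> ?g ` closed_neighborhood ?L v"
        using w(2) by (metis image_eqI restrict_apply')
    qed
  qed
  show "let V = verts ?L; S = f ` V in fall_coloring ?L (card S) S (restrict f V)"
    using properL sees by (simp add: fall_coloring_def Let_def)
qed

end
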